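(* Let $d\ge 2$, $L\ge 4$, and let $\hat H$ be the $S=\frac12$ nearest-neighbor Hamiltonian on the periodic hypercubic lattice $\Lambda=\{1,\dots,L\}^d$ with parameters $J_{\mathrm X},J_{\mathrm Y},J_{\mathrm Z},h_{\mathrm X},h_{\mathrm Y},h_{\mathrm Z}\in\mathbb R$ satisfying $J_{\mathrm X}\neq 0$ and $J_{\mathrm Y}\ne 0$. Let $$\hat Q=\sum_{\boldsymbol{\hat A}\in\mathcal P_\Lambda,\ \operatorname{Wid}\boldsymbol{\hat A}\le 2} q_{\boldsymbol{\hat A}}\,\boldsymbol{\hat A},\qquad q_{\boldsymbol{\hat A}}\in\mathbb C,$$ with $q_{\boldsymbol{\hat A}}\neq 0$ for at least one $\boldsymbol{\hat A}$ with $\operatorname{Wid}\boldsymbol{\hat A}=2$, and suppose $[\hat H,\hat Q]=0$. Then $$\hat Q=\eta\hat H+\hat Q^{(1)}$$ for some $\eta\in\mathbb C\setminus\{0\}$ and some one-body operator $\hat Q^{(1)}$, i.e. a linear combination of $\hat X_u,\hat Y_u,\hat Z_u$ with $u\in\Lambda$.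
   Context: $\Lambda=\{1,\dots,L\}^d$ is the $d$-dimensional hypercubic lattice with periodic boundary conditions (coordinates mod $L$). For $u,v\in\Lambda$, $|u-v|=1$ means that $u,v$ are nearest neighbors, i.e. they differ by $\pm1$ (mod $L$) in exactly one coordinate and agree in the others. Each site carries a copy of $\mathbb C^2$; $\hat X_u,\hat Y_u,\hat Z_u,\hat I_u$ are the Pauli matrices and the identity acting at site $u$ (tensored with the identity elsewhere). The Hamiltonian is $$\hat H=-\frac12\sum_{u,v\in\Lambda,\ |u-v|=1}\{J_{\mathrm X}\hat X_u\hat X_v+J_{\mathrm Y}\hat Y_u\hat Y_v+J_{\mathrm Z}\hat Z_u\hat Z_v\}-\sum_{u\in\Lambda}\{h_{\mathrm X}\hat X_u+h_{\mathrm Y}\hat Y_u+h_{\mathrm Z}\hat Z_u\},$$ the first sum being over ordered pairs. A product (of Pauli matrices) is an operator $\boldsymbol{\hat A}=\bigotimes_{u\in S}\hat A_u$ (tensored with the identity on $\Lambda\setminus S$) with $S\subset\Lambda$ nonempty and $\hat A_u\in\{\hat X_u,\hat Y_u,\hat Z_u\}$; $\operatorname{Supp}\boldsymbol{\hat A}=S$. $\mathcal P_\Lambda$ is the set of all products. For nonempty $S\subset\Lambda$ and $\alpha\in\{1,\dots,d\}$, $\operatorname{Wid}_\alpha S$ is the minimum $k$ for which there is $a\in\{1,\dots,L\}$ such that for every $u\in S$ the residue mod $L$ of $(u)_\alpha-a$ lies in $\{0,\dots,k-1\}$, where $(u)_\alpha$ is the $\alpha$-th coordinate. $\operatorname{Wid}S=\max_\alpha\operatorname{Wid}_\alpha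 S$ and $\operatorname{Wid}\boldsymbol{\hat A}=\operatorname{Wid}\operatorname{Supp}\boldsymbol{\hat A}$. *)

theory Defs
  imports
    "HOL-Analysis.Analysis"
    "Berlekamp_Zassenhaus.Finite_Field"
begin

text \<open>
  The lattice is the discrete torus: a site is a \<^typ>\<open>'d\<close>-tuple of residues modulo
  \<open>L = CARD('l)\<close>, so the dimension is \<open>CARD('d)\<close> and the boundary conditions are periodic by
  construction.
\<close>

type_synonym ('l, 'd) site = "'l mod_ring ^ 'd"

definition nearest_neighbors ::
  "('l::nontriv, 'd::finite) site \<Rightarrow> ('l, 'd) site \<Rightarrow> bool" where
  "nearest_neighbors u v \<longleftrightarrow>
     (\<exists>\<alpha>. (v $ \<alpha> = u $ \<alpha> + 1 \<or> v $ \<alpha> = u $ \<alpha> - 1) \<and> (\<forall>\<beta>. \<beta> \<noteq> \<alpha> \<longrightarrow> v $ \<beta> = u $ \<beta>))"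

definition Wid_along :: "'d::finite \<Rightarrow> ('l::nontriv, 'd) site set \<Rightarrow> nat" where
  "Wid_along \<alpha> S = (LEAST k. \<exists>a. \<forall>u\<in>S. to_int_mod_ring (u $ \<alpha> - a) \<in> {0..<int k})"

definition Wid :: "('l::nontriv, 'd::finite) site set \<Rightarrow> nat" where
  "Wid S = (MAX \<alpha>. Wid_along \<alpha> S)"

text \<open>
  Operators on the tensor product of the spaces \<open>\<complex>\<^sup>2\<close> over all sites are matrices indexed by the
  standard product basis, i.e. by the maps from sites to the two-element index type \<^typ>\<open>2\<close>.
  The composition of operators is \<open>**\<close>; the type class operation \<open>*\<close> on these matrices is entrywise.
\<close>

type_synonym ('l, 'd) config = "2 ^ ('l, 'd) site"
type_synonym ('l, 'd) operator = "complex ^ ('l, 'd) config ^ ('l, 'd) config"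

definition cscale :: "complex \<Rightarrow> complex ^ 'm ^ 'n \<Rightarrow> complex ^ 'm ^ 'n"  (infixr \<open>*\<^sub>c\<close> 75) where
  "c *\<^sub>c A = (\<chi> i j. c * A $ i $ j)"

datatype pauli = PX | PY | PZ

lemma UNIV_pauli: "(UNIV :: pauli set) = {PX, PY, PZ}"
  using pauli.exhaust by auto

instance pauli :: finite
  by standard (simp add: UNIV_pauli)

fun pauli_matrix :: "pauli \<Rightarrow> complex ^ 2 ^ 2" where
  "pauli_matrix PX = vector [vector [0, 1], vector [1, 0]]"
| "pauli_matrix PY = vector [vector [0, - \<i>], vector [\<i>, 0]]"
| "pauli_matrix PZ = vector [vector [1, 0], vector [0, -1]]"

definition tensor ::
  "(('l::nontriv, 'd::finite) site \<Rightarrow> complex ^ 2 ^ 2) \<Rightarrow> ('l, 'd) operator" where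
  "tensor M = (\<chi> s t. \<Prod>u\<in>UNIV. M u $ (s $ u) $ (t $ u))"

definition site_op :: "pauli \<Rightarrow> ('l::nontriv, 'd::finite) site \<Rightarrow> ('l, 'd) operator" where
  "site_op p u = tensor (\<lambda>v. if v = u then pauli_matrix p else mat 1)"

text \<open>
  A product of Pauli matrices is given by the partial map that sends each site of its support to
  the Pauli matrix acting there. Different maps yield different (in fact linearly independent)
  operators, so sums over products may be taken over these maps, and the support of a product is
  the domain of its map.
\<close>

type_synonym ('l, 'd) pauli_product = "('l, 'd) site \<rightharpoonup> pauli"

definition products :: "('l::nontriv, 'd::finite) pauli_product set" where
  "products = {A. dom A \<noteq> {}}"

definition product_op :: "('l::nontriv, 'd::finite) pauli_product \<Rightarrow> ('l, 'd) operator" where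
  "product_op A = tensor (\<lambda>u. case A u of None \<Rightarrow> mat 1 | Some p \<Rightarrow> pauli_matrix p)"

definition hamiltonian ::
  "real \<Rightarrow> real \<Rightarrow> real \<Rightarrow> real \<Rightarrow> real \<Rightarrow> real \<Rightarrow> ('l::nontriv, 'd::finite) operator" where
  "hamiltonian J\<^sub>X J\<^sub>Y J\<^sub>Z h\<^sub>X h\<^sub>Y h\<^sub>Z =
     (- 1 / 2) *\<^sub>c (\<Sum>(u, v) \<in> {(u, v). nearest_neighbors u v}.
         of_real J\<^sub>X *\<^sub>c (site_op PX u ** site_op PX v)
       + of_real J\<^sub>Y *\<^sub>c (site_op PY u ** site_op PY v)
       + of_real J\<^sub>Z *\<^sub>c (site_op PZ u ** site_op PZ v))
     - (\<Sum>u\<in>UNIV. of_real h\<^sub>X *\<^sub>c site_op PX u + of_real h\<^sub>Y *\<^sub>c site_op PY u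
                  + of_real h\<^sub>Z *\<^sub>c site_op PZ u)"

definition one_body :: "('l::nontriv, 'd::finite) operator \<Rightarrow> bool" where
  "one_body Q \<longleftrightarrow> (\<exists>c :: pauli \<Rightarrow> ('l, 'd) site \<Rightarrow> complex.
     Q = (\<Sum>u\<in>UNIV. c PX u *\<^sub>c site_op PX u + c PY u *\<^sub>c site_op PY u + c PZ u *\<^sub>c site_op PZ u))"

end

theory Submission
  imports Defs
begin

text \<open>
  Taking the coefficient of a product \<open>B\<close> in \<open>[H, Q] = 0\<close> gives a linear relation among the \<open>q\<^bsub>A\<^esub>\<close>
  with \<open>A\<close> obtained from \<open>B\<close> by multiplying with a bond or site term of \<open>H\<close> that anticommutes
  with \<open>B\<close>.

  Let \<open>A\<close> have extent 2 in some direction, with layers \<open>a\<close> and \<open>a + 1\<close>. Let \<open>B\<close> be the commutator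
  of \<open>A\<close> with a term \<open>X X\<close> or \<open>Y Y\<close> on a bond from layer \<open>a + 1\<close> to layer \<open>a + 2\<close>. Another product
  of width at most 2 can give \<open>B\<close> only if cancelling a single site, joined by a bond to a site of
  layer \<open>a + 1\<close>, removes the whole layer \<open>a\<close>. The same holds with the layers exchanged, so
  \<open>q\<^bsub>A\<^esub> = 0\<close> unless \<open>A\<close> acts on the two ends of a bond.

  For two bonds \<open>v u\<close> and \<open>u w\<close> and \<open>B = P\<^sub>v T\<^sub>u W\<^sub>w\<close> only two terms survive. For \<open>P = W\<close> with
  \<open>J\<^sub>P \<noteq> 0\<close> this says that the coefficient of \<open>P\<^sub>v R\<^sub>u\<close>, \<open>P \<noteq> R\<close>, changes sign when \<open>v\<close> is replaced by
  another neighbor of \<open>u\<close>, so it vanishes because \<open>u\<close> has at least three neighbors; and of two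
  different \<open>P\<close>, \<open>R\<close> at least one is \<open>X\<close> or \<open>Y\<close>. For \<open>P \<noteq> W\<close> it makes the coefficients of
  \<open>P P\<close> on \<open>v u\<close> and \<open>W W\<close> on \<open>u w\<close> proportional to \<open>J\<^sub>P\<close> and \<open>J\<^sub>W\<close>; since the lattice is connected, the
  factor is the same on all bonds.
\<close>

section \<open>Products of Pauli matrices\<close>

definition opt_pauli_matrix :: "pauli option \<Rightarrow> complex ^ 2 ^ 2" where
  "opt_pauli_matrix a = (case a of None \<Rightarrow> mat 1 | Some p \<Rightarrow> pauli_matrix p)"

text \<open>The last equation is only a default for equal arguments; the function is always applied
  to two different labels.\<close>

fun third_pauli :: "pauli \<Rightarrow> pauli \<Rightarrow> pauli" where
  "third_pauli PX PY = PZ" | "third_pauli PY PX = PZ"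
| "third_pauli PY PZ = PX" | "third_pauli PZ PY = PX"
| "third_pauli PZ PX = PY" | "third_pauli PX PZ = PY"
| "third_pauli p q = p"

text \<open>Up to phases the Pauli matrices and the identity form the Klein four-group, with
  \<open>None\<close> as unit and every element its own inverse; \<open>pauli_phase\<close> records
  the lost phase.\<close>

fun pauli_mult :: "pauli option \<Rightarrow> pauli option \<Rightarrow> pauli option" where
  "pauli_mult None b = b"
| "pauli_mult (Some p) None = Some p"
| "pauli_mult (Some p) (Some q) = (if p = q then None else Some (third_pauli p q))"

fun pauli_phase :: "pauli option \<Rightarrow> pauli option \<Rightarrow> complex" where
  "pauli_phase (Some PX) (Some PY) = \<i>" | "pauli_phase (Some PY) (Some PX) = - \<i>"
| "pauli_phase (Some PY) (Some PZ) = \<i>" | "pauli_phase (Some PZ) (Some PY) = - \<i>"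
| "pauli_phase (Some PZ) (Some PX) = \<i>" | "pauli_phase (Some PX) (Some PZ) = - \<i>"
| "pauli_phase a b = 1"

definition anticommute :: "pauli option \<Rightarrow> pauli option \<Rightarrow> bool" where
  "anticommute a b \<longleftrightarrow> a \<noteq> None \<and> b \<noteq> None \<and> a \<noteq> b"

lemma pauli_option_exhaust:
  obtains "a = None" | "a = Some PX" | "a = Some PY" | "a = Some PZ"
  by (metis option.exhaust pauli.exhaust)

lemma opt_pauli_matrix_mult:
  "opt_pauli_matrix a ** opt_pauli_matrix b = pauli_phase a b *\<^sub>c opt_pauli_matrix (pauli_mult a b)"
  by (cases a rule: pauli_option_exhaust; cases b rule: pauli_option_exhaust)
    (simp_all add: vec_eq_iff matrix_matrix_mult_def opt_pauli_matrix_def cscale_def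
      UNIV_2 sum_2 forall_2 mat_def)

lemma trace_opt_pauli_matrix_mult:
  "trace (opt_pauli_matrix a ** opt_pauli_matrix b) = (if a = b then 2 else 0)"
  by (cases a rule: pauli_option_exhaust; cases b rule: pauli_option_exhaust)
    (simp_all add: trace_def matrix_matrix_mult_def opt_pauli_matrix_def sum_2 mat_def)

lemma pauli_phase_swap:
  "pauli_phase b a = (if anticommute a b then - pauli_phase a b else pauli_phase a b)"
  by (cases a rule: pauli_option_exhaust; cases b rule: pauli_option_exhaust)
    (simp_all add: anticommute_def)

lemma pauli_phase_eq_1: "\<not> anticommute a b \<Longrightarrow> pauli_phase a b = 1"
  by (cases a rule: pauli_option_exhaust; cases b rule: pauli_option_exhaust)
    (simp_all add: anticommute_def)

lemma pauli_phase_nonzero [simp]: "pauli_phase a b \<noteq> 0"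
  by (cases a rule: pauli_option_exhaust; cases b rule: pauli_option_exhaust) simp_all

lemma pauli_phase_None_left [simp]: "pauli_phase None a = 1"
  by (cases a rule: pauli_option_exhaust) simp_all

lemma pauli_mult_commute: "pauli_mult a b = pauli_mult b a"
  by (cases a rule: pauli_option_exhaust; cases b rule: pauli_option_exhaust) simp_all

lemma pauli_mult_None_right [simp]: "pauli_mult a None = a"
  by (cases a) simp_all

lemma pauli_mult_cancel [simp]: "pauli_mult (pauli_mult a b) b = a"
  by (cases a rule: pauli_option_exhaust; cases b rule: pauli_option_exhaust) simp_all

lemma pauli_mult_eq_None_iff [simp]: "pauli_mult a b = None \<longleftrightarrow> a = b"
  by (cases a rule: pauli_option_exhaust; cases b rule: pauli_option_exhaust) simp_all

lemma anticommute_mult: "anticommute a b \<Longrightarrow> anticommute (pauli_mult a b) b"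
  by (cases a rule: pauli_option_exhaust; cases b rule: pauli_option_exhaust)
    (simp_all add: anticommute_def)

text \<open>Distributivity, with the choice functions read as configurations. It makes matrix
  products and traces of tensor products factor over the sites.\<close>

lemma sum_prod_vec:
  fixes f :: "'n::finite \<Rightarrow> 'a::finite \<Rightarrow> 'b::comm_semiring_1"
  shows "(\<Sum>s\<in>(UNIV::('a ^ 'n) set). \<Prod>u\<in>UNIV. f u (s $ u)) = (\<Prod>u\<in>UNIV. \<Sum>i\<in>UNIV. f u i)"
proof -
  have "(\<Prod>u\<in>UNIV. \<Sum>i\<in>UNIV. f u i) = (\<Sum>g\<in>UNIV. \<Prod>u\<in>UNIV. f u (g u))"
    by (subst prod_sum_PiE) (simp_all add: PiE_UNIV_domain)
  also have "\<dots> = (\<Sum>s\<in>(UNIV::('a ^ 'n) set). \<Prod>u\<in>UNIV. f u (s $ u))"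
    by (rule sum.reindex_bij_witness[of _ vec_nth vec_lambda]) auto
  finally show ?thesis ..
qed

lemma tensor_mult: "tensor M ** tensor N = tensor (\<lambda>u. M u ** N u)"
  by (simp add: vec_eq_iff tensor_def matrix_matrix_mult_def prod.distrib[symmetric]
      sum_prod_vec[of "\<lambda>u i. M u $ (_ $ u) $ i * N u $ i $ (_ $ u)"])

lemma trace_tensor: "trace (tensor M) = (\<Prod>u\<in>UNIV. trace (M u))"
  by (simp add: tensor_def trace_def sum_prod_vec[of "\<lambda>u i. M u $ i $ i"])

lemma tensor_cscale: "tensor (\<lambda>u. c u *\<^sub>c M u) = (\<Prod>u\<in>UNIV. c u) *\<^sub>c tensor M"
  by (simp add: vec_eq_iff tensor_def cscale_def prod.distrib)

section \<open>Linearity of scaling, matrix product and trace\<close>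

lemma cscale_mult_left: "(c *\<^sub>c M) ** N = c *\<^sub>c (M ** N)"
  by (simp add: vec_eq_iff cscale_def matrix_matrix_mult_def sum_distrib_left mult.assoc)

lemma cscale_mult_right: "M ** (c *\<^sub>c N) = c *\<^sub>c (M ** N)"
  by (simp add: vec_eq_iff cscale_def matrix_matrix_mult_def sum_distrib_left mult_ac)

lemma cscale_add_right: "c *\<^sub>c (M + N) = c *\<^sub>c M + c *\<^sub>c N"
  by (simp add: vec_eq_iff cscale_def distrib_left)

lemma cscale_diff_right: "c *\<^sub>c (M - N) = c *\<^sub>c M - c *\<^sub>c N"
  by (simp add: vec_eq_iff cscale_def right_diff_distrib)

lemma cscale_add_left: "(a + b) *\<^sub>c M = a *\<^sub>c M + b *\<^sub>c M"
  by (simp add: vec_eq_iff cscale_def distrib_right)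

lemma cscale_cscale: "a *\<^sub>c b *\<^sub>c M = (a * b) *\<^sub>c M"
  by (simp add: vec_eq_iff cscale_def)

lemma cscale_zero [simp]: "0 *\<^sub>c M = 0" "c *\<^sub>c 0 = 0"
  by (simp_all add: vec_eq_iff cscale_def)

lemma cscale_one [simp]: "1 *\<^sub>c M = M"
  by (simp add: vec_eq_iff cscale_def)

lemma cscale_sum_right: "c *\<^sub>c (\<Sum>i\<in>I. f i) = (\<Sum>i\<in>I. c *\<^sub>c f i)"
  by (induction I rule: infinite_finite_induct) (simp_all add: cscale_add_right)

lemma trace_cscale: "trace (c *\<^sub>c M) = c * trace M"
  by (simp add: trace_def cscale_def sum_distrib_left)

lemma matrix_add_rdistrib: "(A + B) ** C = A ** C + B ** C"
  by (simp add: vec_eq_iff matrix_matrix_mult_def distrib_right sum.distrib)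

lemma matrix_diff_ldistrib: "A ** (B - C) = A ** B - A ** C"
  for A :: "'a::ring_1 ^ 'n ^ 'm"
  by (simp add: vec_eq_iff matrix_matrix_mult_def right_diff_distrib sum_subtractf)

lemma matrix_diff_rdistrib: "(A - B) ** C = A ** C - B ** C"
  for A :: "'a::ring_1 ^ 'n ^ 'm"
  by (simp add: vec_eq_iff matrix_matrix_mult_def left_diff_distrib sum_subtractf)

lemma matrix_mult_sum_left: "(\<Sum>i\<in>I. f i) ** M = (\<Sum>i\<in>I. f i ** M)"
  for M :: "'a::semiring_1 ^ 'n ^ 'm"
  by (induction I rule: infinite_finite_induct) (simp_all add: matrix_add_rdistrib)

lemma matrix_mult_sum_right: "M ** (\<Sum>i\<in>I. f i) = (\<Sum>i\<in>I. M ** f i)"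
  for M :: "'a::semiring_1 ^ 'n ^ 'm"
  by (induction I rule: infinite_finite_induct) (simp_all add: matrix_add_ldistrib)

lemma trace_sum: "trace (\<Sum>i\<in>I. f i) = (\<Sum>i\<in>I. trace (f i))"
  for f :: "'i \<Rightarrow> 'a::comm_ring_1 ^ 'n ^ 'n"
  by (induction I rule: infinite_finite_induct) (simp_all add: trace_add, simp_all add: trace_def)

section \<open>Products of Pauli matrices and their commutators\<close>

lemma product_op_eq: "product_op A = tensor (\<lambda>u. opt_pauli_matrix (A u))"
  by (simp add: product_op_def opt_pauli_matrix_def)

lemma product_op_mult:
  "product_op A ** product_op B =
     (\<Prod>u\<in>UNIV. pauli_phase (A u) (B u)) *\<^sub>c product_op (\<lambda>u. pauli_mult (A u) (B u))"
  by (simp add: product_op_eq tensor_mult opt_pauli_matrix_mult tensor_cscale)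

text \<open>The trace factors over the sites, and one site where \<open>A\<close> and
  \<open>B\<close> differ contributes 0. This orthogonality turns coefficients into traces.\<close>

lemma trace_product_op_mult:
  fixes A B :: "('l::nontriv, 'd::finite) pauli_product"
  shows "trace (product_op A ** product_op B) = (if A = B then 2 ^ CARD(('l, 'd) site) else 0)"
proof (cases "A = B")
  case False
  then obtain u where "A u \<noteq> B u" by blast
  then have "(\<Prod>u\<in>UNIV. (if A u = B u then 2 else 0 :: complex)) = 0"
    by (intro prod_zero) auto
  with False show ?thesis
    by (simp add: product_op_eq tensor_mult trace_tensor trace_opt_pauli_matrix_mult)
qed (simp add: product_op_eq tensor_mult trace_tensor trace_opt_pauli_matrix_mult)

lemma site_op_eq: "site_op p u = product_op [u \<mapsto> p]"
  unfolding site_op_def product_op_def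
  by (rule arg_cong[where f = tensor]) auto

lemma site_op_mult:
  assumes "u \<noteq> v"
  shows "site_op p u ** site_op r v = product_op [u \<mapsto> p, v \<mapsto> r]"
  unfolding site_op_def product_op_def tensor_mult
  using assms by (intro arg_cong[where f = tensor]) (auto simp: fun_eq_iff)

lemma nearest_neighbors_imp_neq: "nearest_neighbors u v \<Longrightarrow> u \<noteq> v"
  by (auto simp: nearest_neighbors_def)

lemma nearest_neighbors_sym: "nearest_neighbors u v \<Longrightarrow> nearest_neighbors v u"
  unfolding nearest_neighbors_def by (metis add_diff_cancel diff_add_cancel)

text \<open>By cyclicity the trace is that of \<open>(B C - C B) A\<close>, and orthogonality leaves
  only the \<open>A\<close> that equals \<open>B C\<close> up to a phase.\<close>

lemma trace_commutator_product_op: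
  fixes A B C :: "('l::nontriv, 'd::finite) pauli_product"
  shows "trace (product_op B ** (product_op C ** product_op A - product_op A ** product_op C)) =
    (if A = (\<lambda>u. pauli_mult (B u) (C u))
     then 2 ^ CARD(('l, 'd) site) * ((\<Prod>u\<in>UNIV. pauli_phase (B u) (C u))
       - (\<Prod>u\<in>UNIV. pauli_phase (C u) (B u))) else 0)"
proof -
  have "trace (product_op B ** (product_op C ** product_op A - product_op A ** product_op C))
    = trace ((product_op B ** product_op C) ** product_op A)
      - trace ((product_op B ** product_op A) ** product_op C)"
    by (simp add: matrix_diff_ldistrib trace_sub matrix_mul_assoc)
  also have "trace ((product_op B ** product_op A) ** product_op C)
    = trace ((product_op C ** product_op B) ** product_op A)"
    by (simp add: trace_mul_sym[of _ "product_op C"] matrix_mul_assoc)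
  also note product_op_mult[of B C]
  also note product_op_mult[of C B]
  finally show ?thesis
    by (simp add: cscale_mult_left trace_cscale trace_product_op_mult
        pauli_mult_commute[of "C _"] right_diff_distrib eq_commute[of A])
qed

lemma trace_commutator_expansion:
  fixes q :: "('l::nontriv, 'd::finite) pauli_product \<Rightarrow> complex"
  assumes Q: "Q = (\<Sum>A\<in>UNIV. q A *\<^sub>c product_op A)"
  shows "trace (product_op B ** (product_op C ** Q - Q ** product_op C)) =
    2 ^ CARD(('l, 'd) site) * ((\<Prod>u\<in>UNIV. pauli_phase (B u) (C u))
       - (\<Prod>u\<in>UNIV. pauli_phase (C u) (B u))) * q (\<lambda>u. pauli_mult (B u) (C u))"
proof -
  have "trace (product_op B ** (product_op C ** Q - Q ** product_op C)) =
    (\<Sum>A\<in>UNIV. q A * trace (product_op B **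
      (product_op C ** product_op A - product_op A ** product_op C)))"
    unfolding Q matrix_mult_sum_left matrix_mult_sum_right sum_subtractf[symmetric] trace_sum
    by (simp add: cscale_mult_left cscale_mult_right trace_cscale cscale_diff_right[symmetric])
  then show ?thesis
    unfolding trace_commutator_product_op by (simp add: if_distrib mult.commute cong: if_cong)
qed

lemma trace_commutator_site:
  fixes q :: "('l::nontriv, 'd::finite) pauli_product \<Rightarrow> complex"
  assumes Q: "Q = (\<Sum>A\<in>UNIV. q A *\<^sub>c product_op A)"
  shows "trace (product_op B ** (product_op [x \<mapsto> p] ** Q - Q ** product_op [x \<mapsto> p])) =
    2 * 2 ^ CARD(('l, 'd) site) * (if anticommute (B x) (Some p)
      then pauli_phase (B x) (Some p) * q (B(x := pauli_mult (B x) (Some p))) else 0)"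
proof -
  have "(\<Prod>u\<in>UNIV. pauli_phase (B u) ([x \<mapsto> p] u)) = (\<Prod>u\<in>{x}. pauli_phase (B u) ([x \<mapsto> p] u))"
    by (rule prod.mono_neutral_right) auto
  moreover have "(\<Prod>u\<in>UNIV. pauli_phase ([x \<mapsto> p] u) (B u)) = (\<Prod>u\<in>{x}. pauli_phase ([x \<mapsto> p] u) (B u))"
    by (rule prod.mono_neutral_right) auto
  moreover have "(\<lambda>u. pauli_mult (B u) ([x \<mapsto> p] u)) = B(x := pauli_mult (B x) (Some p))"
    by auto
  ultimately show ?thesis
    unfolding trace_commutator_expansion[OF Q] by (simp add: pauli_phase_swap[of "Some p"])
qed

text \<open>
  Of two sites whose Pauli matrices are multiplied by a bond term that does not commute with the
  product, exactly one anticommutes with its factor; summands are oriented with that site first.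
\<close>

definition bond_coeff :: "(('l::nontriv, 'd::finite) pauli_product \<Rightarrow> complex) \<Rightarrow>
    ('l, 'd) pauli_product \<Rightarrow> pauli \<Rightarrow> ('l, 'd) site \<Rightarrow> ('l, 'd) site \<Rightarrow> complex" where
  "bond_coeff q B p x y =
    (if anticommute (B x) (Some p) \<and> \<not> anticommute (B y) (Some p)
     then pauli_phase (B x) (Some p) *
       q (B(x := pauli_mult (B x) (Some p), y := pauli_mult (B y) (Some p))) else 0)"

definition site_coeff :: "(('l::nontriv, 'd::finite) pauli_product \<Rightarrow> complex) \<Rightarrow>
    ('l, 'd) pauli_product \<Rightarrow> pauli \<Rightarrow> ('l, 'd) site \<Rightarrow> complex" where
  "site_coeff q B p x =
    (if anticommute (B x) (Some p)
     then pauli_phase (B x) (Some p) * q (B(x := pauli_mult (B x) (Some p))) else 0)"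

text \<open>The two orientations are mutually exclusive. The site that commutes with
  \<open>p\<close> has phase 1, and the opposite phases at the other site give the factor 2.\<close>

lemma trace_commutator_bond:
  fixes q :: "('l::nontriv, 'd::finite) pauli_product \<Rightarrow> complex"
  assumes Q: "Q = (\<Sum>A\<in>UNIV. q A *\<^sub>c product_op A)" and "x \<noteq> y"
  shows "trace (product_op B ** (product_op [x \<mapsto> p, y \<mapsto> p] ** Q - Q ** product_op [x \<mapsto> p, y \<mapsto> p])) =
    2 * 2 ^ CARD(('l, 'd) site) * (bond_coeff q B p x y + bond_coeff q B p y x)"
proof -
  let ?C = "[x \<mapsto> p, y \<mapsto> p]"
  have "(\<Prod>u\<in>UNIV. pauli_phase (B u) (?C u)) = (\<Prod>u\<in>{x, y}. pauli_phase (B u) (?C u))"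
    by (rule prod.mono_neutral_right) auto
  moreover have "(\<Prod>u\<in>UNIV. pauli_phase (?C u) (B u)) = (\<Prod>u\<in>{x, y}. pauli_phase (?C u) (B u))"
    by (rule prod.mono_neutral_right) auto
  moreover have "(\<lambda>u. pauli_mult (B u) (?C u)) =
      B(x := pauli_mult (B x) (Some p), y := pauli_mult (B y) (Some p))"
    by auto
  moreover have "B(y := pauli_mult (B y) (Some p), x := pauli_mult (B x) (Some p)) =
      B(x := pauli_mult (B x) (Some p), y := pauli_mult (B y) (Some p))"
    using \<open>x \<noteq> y\<close> by auto
  ultimately show ?thesis
    unfolding trace_commutator_expansion[OF Q] bond_coeff_def
    using \<open>x \<noteq> y\<close> by (simp add: pauli_phase_swap[of "Some p"] pauli_phase_eq_1)
qed

section \<open>The Hamiltonian and the coefficient equations\<close>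

lemma hamiltonian_eq:
  "(hamiltonian J\<^sub>X J\<^sub>Y J\<^sub>Z h\<^sub>X h\<^sub>Y h\<^sub>Z :: ('l::nontriv, 'd::finite) operator) =
     (- 1 / 2) *\<^sub>c (\<Sum>(u, v)\<in>{(u, v). nearest_neighbors u v}. \<Sum>p\<in>UNIV.
       of_real (case_pauli J\<^sub>X J\<^sub>Y J\<^sub>Z p) *\<^sub>c product_op [u \<mapsto> p, v \<mapsto> p])
     - (\<Sum>u\<in>UNIV. \<Sum>p\<in>UNIV. of_real (case_pauli h\<^sub>X h\<^sub>Y h\<^sub>Z p) *\<^sub>c product_op [u \<mapsto> p])"
proof -
  have "(\<Sum>(u :: ('l, 'd) site, v)\<in>{(u, v). nearest_neighbors u v}.
         of_real J\<^sub>X *\<^sub>c (site_op PX u ** site_op PX v)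
       + of_real J\<^sub>Y *\<^sub>c (site_op PY u ** site_op PY v)
       + of_real J\<^sub>Z *\<^sub>c (site_op PZ u ** site_op PZ v)) =
    (\<Sum>(u, v)\<in>{(u, v). nearest_neighbors u v}. \<Sum>p\<in>UNIV.
       of_real (case_pauli J\<^sub>X J\<^sub>Y J\<^sub>Z p) *\<^sub>c product_op [u \<mapsto> p, v \<mapsto> p])"
    by (rule sum.cong)
      (auto simp: UNIV_pauli site_op_mult nearest_neighbors_imp_neq add.assoc)
  from this[unfolded case_prod_unfold] show ?thesis
    unfolding hamiltonian_def case_prod_unfold by (simp only:) (simp add: site_op_eq UNIV_pauli add.assoc)
qed

lemma sum_nearest_neighbors_swap:
  "(\<Sum>(u, v)\<in>{(u, v). nearest_neighbors u v}. f v u) =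
   (\<Sum>(u, v)\<in>{(u, v). nearest_neighbors u v}. f u v)"
  by (rule sum.reindex_bij_witness[of _ prod.swap prod.swap]) (auto intro: nearest_neighbors_sym)

lemma commuting_imp_coefficient_equation:
  fixes q :: "('l::nontriv, 'd::finite) pauli_product \<Rightarrow> complex"
  assumes H: "H = hamiltonian J\<^sub>X J\<^sub>Y J\<^sub>Z h\<^sub>X h\<^sub>Y h\<^sub>Z"
    and Q: "Q = (\<Sum>A\<in>UNIV. q A *\<^sub>c product_op A)"
    and comm: "H ** Q - Q ** H = 0"
  shows "(\<Sum>(x, y)\<in>{(x, y). nearest_neighbors x y}. \<Sum>p\<in>UNIV.
       of_real (case_pauli J\<^sub>X J\<^sub>Y J\<^sub>Z p) * bond_coeff q B p x y)
     + (\<Sum>x\<in>UNIV. \<Sum>p\<in>UNIV. of_real (case_pauli h\<^sub>X h\<^sub>Y h\<^sub>Z p) * site_coeff q B p x) = 0"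
proof -
  \<comment> \<open>\<open>F\<close> pairs the commutator with \<open>B\<close>, which extracts the
    coefficient of \<open>B\<close> up to a constant; it is linear in \<open>M\<close>.\<close>
  define F where "F M = trace (product_op B ** (M ** Q - Q ** M))" for M
  let ?N = "{(x :: ('l, 'd) site, y). nearest_neighbors x y}"
  let ?J = "\<lambda>p. complex_of_real (case_pauli J\<^sub>X J\<^sub>Y J\<^sub>Z p)"
  let ?h = "\<lambda>p. complex_of_real (case_pauli h\<^sub>X h\<^sub>Y h\<^sub>Z p)"
  define K :: complex where "K = 2 * 2 ^ CARD(('l, 'd) site)"
  have F_diff: "F (M - N) = F M - F N" for M N
    by (simp add: F_def matrix_diff_ldistrib matrix_diff_rdistrib trace_sub)
  have F_cscale: "F (c *\<^sub>c M) = c * F M" for c M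
    by (simp add: F_def cscale_mult_left cscale_mult_right trace_cscale
        cscale_diff_right[symmetric])
  have F_sum: "F (\<Sum>i\<in>I. f i) = (\<Sum>i\<in>I. F (f i))" for f and I :: "'i set"
    by (simp add: F_def matrix_mult_sum_left matrix_mult_sum_right trace_sum
        sum_subtractf[symmetric])
  have "0 = F H"
    using comm by (simp add: F_def trace_def)
  also have "\<dots> = - (1/2) * (\<Sum>(x, y)\<in>?N. \<Sum>p\<in>UNIV. ?J p * F (product_op [x \<mapsto> p, y \<mapsto> p]))
      - (\<Sum>x\<in>UNIV. \<Sum>p\<in>UNIV. ?h p * F (product_op [x \<mapsto> p]))"
    unfolding H hamiltonian_eq by (simp add: F_diff F_cscale F_sum case_prod_unfold)
  also have "(\<Sum>x\<in>UNIV. \<Sum>p\<in>UNIV. ?h p * F (product_op [x \<mapsto> p])) =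
      K * (\<Sum>x\<in>UNIV. \<Sum>p\<in>UNIV. ?h p * site_coeff q B p x)"
    by (simp add: F_def trace_commutator_site[OF Q] site_coeff_def[symmetric] K_def
        sum_distrib_left mult_ac)
  also have "(\<Sum>(x, y)\<in>?N. \<Sum>p\<in>UNIV. ?J p * F (product_op [x \<mapsto> p, y \<mapsto> p])) =
      (\<Sum>(x, y)\<in>?N. \<Sum>p\<in>UNIV. K * (?J p * bond_coeff q B p x y) + K * (?J p * bond_coeff q B p y x))"
    by (rule sum.cong) (auto simp: F_def trace_commutator_bond[OF Q] nearest_neighbors_imp_neq
        K_def distrib_left mult_ac)
  also have "\<dots> = K * (\<Sum>(x, y)\<in>?N. \<Sum>p\<in>UNIV. ?J p * bond_coeff q B p x y)
      + K * (\<Sum>(x, y)\<in>?N. \<Sum>p\<in>UNIV. ?J p * bond_coeff q B p y x)"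
    by (simp add: sum.distrib sum_distrib_left case_prod_unfold)
  \<comment> \<open>Both orientations have the same sum over ordered pairs, which cancels the factor
    1/2 of the Hamiltonian.\<close>
  also note sum_nearest_neighbors_swap[of "\<lambda>x y. \<Sum>p\<in>UNIV. ?J p * bond_coeff q B p x y"]
  finally have "K * ((\<Sum>(x, y)\<in>?N. \<Sum>p\<in>UNIV. ?J p * bond_coeff q B p x y)
      + (\<Sum>x\<in>UNIV. \<Sum>p\<in>UNIV. ?h p * site_coeff q B p x)) = 0"
    by (simp add: distrib_left add_eq_0_iff)
  moreover have "K \<noteq> 0"
    by (simp add: K_def)
  ultimately show ?thesis by simp
qed

section \<open>The discrete torus\<close>

lemma of_nat_mod_ring_neq_0:
  assumes "0 < n" "n < CARD('l)"
  shows "(of_nat n :: 'l::nontriv mod_ring) \<noteq> 0"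
proof
  assume "(of_nat n :: 'l mod_ring) = 0"
  then have "to_int_mod_ring (of_int_mod_ring (int n) :: 'l mod_ring) = 0"
    by (simp add: of_nat_of_int_mod_ring)
  with assms show False by simp
qed

lemma of_nat_mod_ring_surj: "\<exists>n. (t :: 'l::nontriv mod_ring) = of_nat n"
proof -
  have "to_int_mod_ring t \<in> {0..<int CARD('l)}"
    using range_to_int_mod_ring[where 'a = 'l] by blast
  then have "of_nat (nat (to_int_mod_ring t)) = (of_int (to_int_mod_ring t) :: 'l mod_ring)"
    by simp
  then show ?thesis
    by (metis of_int_of_int_mod_ring of_int_mod_ring_to_int_mod_ring)
qed

text \<open>Up to sign \<open>s + s - t\<close> is 1, 2 or 3, none of which is 0 modulo
  \<open>L\<close>. Every use of \<open>L \<ge> 4\<close> goes through this fact.\<close>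

lemma double_step_neq:
  fixes s t :: "'l::nontriv mod_ring"
  assumes "CARD('l) \<ge> 4" and "s = 1 \<or> s = - 1" and "t = 0 \<or> t = 1 \<or> t = - 1"
  shows "s + s \<noteq> t"
proof
  have 2: "(2 :: 'l mod_ring) \<noteq> 0" and 3: "(3 :: 'l mod_ring) \<noteq> 0"
    using of_nat_mod_ring_neq_0[where 'l = 'l, of 2] of_nat_mod_ring_neq_0[where 'l = 'l, of 3]
      assms(1) by auto
  have 1: "(2 :: 'l mod_ring) \<noteq> 1"
    by (metis add_cancel_right_left one_add_one zero_neq_one)
  have three: "(1::'l mod_ring) + 1 + 1 = 3"
    by simp
  assume "s + s = t"
  then have "s + s - t = 0" by simp
  then have "(2 :: 'l mod_ring) = 0 \<or> (1 :: 'l mod_ring) = 0 \<or> (3 :: 'l mod_ring) = 0"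
    using assms(2,3) three 1 by (auto simp: algebra_simps neg_eq_iff_add_eq_0)
  with 2 3 show False by simp
qed

lemma nearest_neighbors_iff_axis:
  "nearest_neighbors u v \<longleftrightarrow> (\<exists>\<alpha> s. (s = 1 \<or> s = - 1) \<and> v = u + axis \<alpha> s)"
proof
  assume "nearest_neighbors u v"
  then obtain \<alpha> s where "s = 1 \<or> s = - 1" "v $ \<alpha> = u $ \<alpha> + s" "\<And>\<beta>. \<beta> \<noteq> \<alpha> \<Longrightarrow> v $ \<beta> = u $ \<beta>"
    unfolding nearest_neighbors_def by (metis diff_conv_add_uminus)
  then show "\<exists>\<alpha> s. (s = 1 \<or> s = - 1) \<and> v = u + axis \<alpha> s"
    by (intro exI[of _ \<alpha>] exI[of _ s]) (auto simp: vec_eq_iff axis_def)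
qed (auto simp: nearest_neighbors_def axis_def)

lemma nearest_neighbors_axis:
  "s = 1 \<or> s = - 1 \<Longrightarrow> nearest_neighbors u (u + axis \<alpha> s)"
  by (auto simp: nearest_neighbors_iff_axis)

lemma nearest_neighbors_coordinate:
  "nearest_neighbors u v \<Longrightarrow> v $ \<alpha> - u $ \<alpha> = 0 \<or> v $ \<alpha> - u $ \<alpha> = 1 \<or> v $ \<alpha> - u $ \<alpha> = - 1"
  by (auto simp: nearest_neighbors_iff_axis axis_def split: if_splits)

text \<open>A bond changes a single coordinate, so a nonzero change along \<open>\<alpha>\<close>
  determines the whole step.\<close>

lemma nearest_neighbors_step:
  assumes "nearest_neighbors u v" "v $ \<alpha> = u $ \<alpha> + s" "s \<noteq> 0"
  shows "v = u + axis \<alpha> s"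
proof -
  obtain \<beta> t where v: "v = u + axis \<beta> t"
    using assms(1) by (auto simp: nearest_neighbors_iff_axis)
  then have "axis \<beta> t $ \<alpha> = s"
    using assms(2) by simp
  with \<open>s \<noteq> 0\<close> show ?thesis
    by (auto simp: v axis_def split: if_splits)
qed

text \<open>Two neighbors of \<open>u\<close> differ by a double step if they lie on the same axis,
  and in two coordinates otherwise. A parity argument would fail for odd \<open>L\<close>, where the
  torus is not bipartite.\<close>

lemma nearest_neighbors_triangle_free:
  fixes u v w :: "('l::nontriv, 'd::finite) site"
  assumes "CARD('l) \<ge> 4" "nearest_neighbors u v" "nearest_neighbors u w"
  shows "\<not> nearest_neighbors v w"
proof
  assume vw: "nearest_neighbors v w"
  obtain \<alpha> s where s: "s = 1 \<or> s = - 1" and v: "v = u + axis \<alpha> s"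
    using assms by (auto simp: nearest_neighbors_iff_axis)
  obtain \<beta> t where t: "t = 1 \<or> t = - 1" and w: "w = u + axis \<beta> t"
    using assms by (auto simp: nearest_neighbors_iff_axis)
  have s0: "s \<noteq> 0" and t0: "t \<noteq> 0"
    using s t by auto
  show False
  proof (cases "\<alpha> = \<beta>")
    case True
    have "v \<noteq> w" using vw by (rule nearest_neighbors_imp_neq)
    then have "t = - s" using s t v w True by auto
    moreover have "w $ \<alpha> - v $ \<alpha> = t - s"
      using True by (simp add: v w axis_def)
    ultimately have "t + t = w $ \<alpha> - v $ \<alpha>" by simp
    with nearest_neighbors_coordinate[OF vw, of \<alpha>] double_step_neq[OF assms(1) t]
    show False by metis
  next
    case False
    then have "w $ \<alpha> = v $ \<alpha> + - s" "w $ \<beta> = v $ \<beta> + t"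
      by (auto simp: v w axis_def)
    with vw s0 t0 have "v + axis \<alpha> (- s) = v + axis \<beta> t"
      by (metis nearest_neighbors_step neg_equal_0_iff_equal)
    then have "axis \<alpha> (- s) = axis \<beta> t" by simp
    then have "axis \<alpha> (- s) $ \<beta> = axis \<beta> t $ \<beta>" by simp
    with False t0 show False by (simp add: axis_def)
  qed
qed

text \<open>The two additional neighbors lie on a second axis, in opposite directions; they differ
  because 2 is nonzero modulo \<open>L\<close>.\<close>

lemma third_neighbors:
  fixes u v :: "('l::nontriv, 'd::finite) site"
  assumes "CARD('d) \<ge> 2" "CARD('l) \<ge> 4" "nearest_neighbors u v"
  obtains w x where "nearest_neighbors u w" "nearest_neighbors u x" "w \<noteq> v" "x \<noteq> v" "w \<noteq> x"
proof -
  obtain \<alpha> s where s: "s = 1 \<or> s = - 1" and v: "v = u + axis \<alpha> s"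
    using assms by (auto simp: nearest_neighbors_iff_axis)
  have "\<exists>\<beta>. \<beta> \<noteq> \<alpha>"
  proof (rule ccontr)
    assume "\<nexists>\<beta>. \<beta> \<noteq> \<alpha>"
    then have "(UNIV :: 'd set) = {\<alpha>}" by auto
    then have "CARD('d) = card {\<alpha>}" by metis
    with assms(1) show False by simp
  qed
  then obtain \<beta> where \<beta>: "\<beta> \<noteq> \<alpha>" ..
  have neq: "u + axis \<beta> t \<noteq> v" if "t = 1 \<or> t = - 1" for t
  proof
    assume "u + axis \<beta> t = v"
    then have "axis \<beta> t $ \<beta> = axis \<alpha> s $ \<beta>" by (simp add: v)
    with \<beta> that show False by (auto simp: axis_def)
  qed
  have "axis \<beta> (1 :: 'l mod_ring) \<noteq> axis \<beta> (- 1)"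
    using double_step_neq[OF assms(2), of 1 0] by (auto simp: axis_eq_axis eq_neg_iff_add_eq_0)
  then have "u + axis \<beta> 1 \<noteq> u + axis \<beta> (- 1)"
    by simp
  then show ?thesis
    using that[of "u + axis \<beta> 1" "u + axis \<beta> (- 1)"] neq by (simp add: nearest_neighbors_axis)
qed

text \<open>Connectedness of the torus: \<open>u\<close> is reached from 0 one coordinate at a time,
  and every residue is a sum of ones.\<close>

lemma nearest_neighbors_invariant_constant:
  fixes f :: "('l::nontriv, 'd::finite) site \<Rightarrow> 'b"
  assumes "\<And>u v. nearest_neighbors u v \<Longrightarrow> f u = f v"
  shows "f u = f 0"
proof -
  have step: "f (u + axis \<alpha> (of_nat n)) = f u" for u \<alpha> n
  proof (induction n)
    case 0
    have "axis \<alpha> 0 = (0 :: ('l, 'd) site)"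
      by (simp add: vec_eq_iff axis_def)
    then show ?case by (simp only: of_nat_0 add_0_right)
  next
    case (Suc n)
    have "u + axis \<alpha> (of_nat (Suc n)) = (u + axis \<alpha> (of_nat n)) + axis \<alpha> 1"
      by (simp add: vec_eq_iff axis_def)
    then show ?case
      using Suc assms nearest_neighbors_axis by metis
  qed
  have axis: "f (u + axis \<alpha> t) = f u" for u \<alpha> t
    using step of_nat_mod_ring_surj[of t] by metis
  have "f (\<Sum>\<alpha>\<in>S. axis \<alpha> (u $ \<alpha>)) = f 0" if "finite S" for S
    using that by induction (simp_all add: axis add.commute[of "axis _ _"])
  moreover have "(\<Sum>\<alpha>\<in>UNIV. axis \<alpha> (u $ \<alpha>)) = u"
    by (simp add: vec_eq_iff axis_def)
  ultimately show ?thesis by (metis finite)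
qed

section \<open>Solutions of the coefficient equations\<close>

text \<open>The coefficient function lives on all partial maps, including the empty one for the
  identity. The width bound is kept only as confinement to two consecutive layers in each
  direction.\<close>

locale width_two_solution =
  fixes J h :: "pauli \<Rightarrow> complex" and q :: "('l::nontriv, 'd::finite) pauli_product \<Rightarrow> complex"
  assumes dimension: "CARD('d) \<ge> 2" and length: "CARD('l) \<ge> 4"
    and JX: "J PX \<noteq> 0" and JY: "J PY \<noteq> 0"
    and equation: "(\<Sum>(x, y)\<in>{(x, y). nearest_neighbors x y}. \<Sum>p\<in>UNIV. J p * bond_coeff q B p x y)
      + (\<Sum>x\<in>UNIV. \<Sum>p\<in>UNIV. h p * site_coeff q B p x) = 0"
    and width: "q A \<noteq> 0 \<Longrightarrow> \<exists>a. \<forall>u\<in>dom A. u $ \<alpha> = a \<or> u $ \<alpha> = a + 1"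
begin

text \<open>
  If all \<open>q\<close>-values on supports containing that of \<open>B\<close> vanish, only the bond terms that cancel
  the factor of \<open>B\<close> at one of their sites survive, and that factor determines the bond term.
\<close>

lemma reduced_equation:
  assumes vanish: "\<And>A. dom B \<subseteq> dom A \<Longrightarrow> q A = 0"
  shows "(\<Sum>(x, y)\<in>{(x, y). nearest_neighbors x y \<and> anticommute (B x) (B y)}.
    J (the (B y)) * pauli_phase (B x) (B y) * q (B(x := pauli_mult (B x) (B y), y := None))) = 0"
proof -
  \<comment> \<open>A site term that anticommutes with \<open>B x\<close> changes the factor there
    but cannot cancel it, so the support is preserved.\<close>
  have "q (B(x := pauli_mult (B x) (Some p))) = 0" if "anticommute (B x) (Some p)" for x p
    using that by (intro vanish) (auto simp: anticommute_def split: if_splits)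
  then have site: "site_coeff q B p x = 0" for x p
    by (simp add: site_coeff_def)
  have 1: "bond_coeff q B p x y = 0" if "\<not> (anticommute (B x) (B y) \<and> Some p = B y)" "x \<noteq> y" for p x y
  \<comment> \<open>At \<open>x\<close> the factors anticommute, so nothing cancels; at
    \<open>y\<close> cancellation would require \<open>B y = Some p\<close>. Otherwise the support
    still contains that of \<open>B\<close>.\<close>
  proof -
    have "q (B(x := pauli_mult (B x) (Some p), y := pauli_mult (B y) (Some p))) = 0"
      if "anticommute (B x) (Some p)" "\<not> anticommute (B y) (Some p)"
    proof (rule vanish)
      have "pauli_mult (B x) (Some p) \<noteq> None" "pauli_mult (B y) (Some p) \<noteq> None"
        using that \<open>\<not> (_ \<and> _)\<close> by (auto simp: anticommute_def)
      then show "dom B \<subseteq> dom (B(x := pauli_mult (B x) (Some p), y := pauli_mult (B y) (Some p)))"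
        by (auto simp: dom_def split: if_splits)
    qed
    then show ?thesis by (simp add: bond_coeff_def)
  qed
  have 2: "bond_coeff q B p x y =
      pauli_phase (B x) (B y) * q (B(x := pauli_mult (B x) (B y), y := None))"
    if "anticommute (B x) (B y)" "Some p = B y" for p x y
    using that(1) by (simp add: bond_coeff_def anticommute_def that(2)[symmetric])
  have "(\<Sum>p\<in>UNIV. J p * bond_coeff q B p x y) =
      (if anticommute (B x) (B y) then J (the (B y)) * pauli_phase (B x) (B y) *
        q (B(x := pauli_mult (B x) (B y), y := None)) else 0)" if "x \<noteq> y" for x y
  proof (cases "anticommute (B x) (B y)")
    case True
    then obtain r where r: "B y = Some r"
      by (auto simp: anticommute_def)
    have "(\<Sum>p\<in>UNIV. J p * bond_coeff q B p x y) = (\<Sum>p\<in>{r}. J p * bond_coeff q B p x y)"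
      by (rule sum.mono_neutral_right) (use 1 r that in auto)
    with True r 2 show ?thesis by simp
  next
    case False
    with 1 that show ?thesis by simp
  qed
  note bond = this[OF nearest_neighbors_imp_neq]
  have "(\<Sum>(x, y)\<in>{(x, y). nearest_neighbors x y \<and> anticommute (B x) (B y)}.
      J (the (B y)) * pauli_phase (B x) (B y) * q (B(x := pauli_mult (B x) (B y), y := None))) =
    (\<Sum>(x, y)\<in>{(x, y). nearest_neighbors x y}. \<Sum>p\<in>UNIV. J p * bond_coeff q B p x y)"
    by (rule sum.mono_neutral_cong_left) (auto simp: bond split: if_splits)
  with equation[of B] site show ?thesis by simp
qed

section \<open>Confinement of supports to single bonds\<close>

lemma anticommuting_coupling:
  obtains r where "J r \<noteq> 0" "r \<noteq> p"
  using JX JY by (cases "p = PX") auto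

text \<open>Coordinates in two consecutive layers differ by 0, 1 or -1, which a double step never
  does.\<close>

lemma opposite_layers_vanish:
  assumes "s = 1 \<or> s = - 1" and "v \<in> dom A" "w \<in> dom A" and "w $ \<alpha> = v $ \<alpha> + (s + s)"
  shows "q A = 0"
proof (rule ccontr)
  assume "q A \<noteq> 0"
  then obtain a where a: "\<forall>u\<in>dom A. u $ \<alpha> = a \<or> u $ \<alpha> = a + 1"
    using width by blast
  have "w $ \<alpha> - v $ \<alpha> = 0 \<or> w $ \<alpha> - v $ \<alpha> = 1 \<or> w $ \<alpha> - v $ \<alpha> = - 1"
    using bspec[OF a assms(2)] bspec[OF a assms(3)] by auto
  then show False
    using double_step_neq[OF length assms(1), of "w $ \<alpha> - v $ \<alpha>"] assms(4) by simp
qed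

text \<open>
  A bond term is attached to a site \<open>z\<close> of the layer \<open>a + s\<close> and sticks out into the layer
  \<open>a + 2 s\<close>. The resulting product is too wide, and it can be reached from another product of
  width at most 2 only by cancelling the whole layer \<open>a\<close>.
\<close>

lemma layer_singleton:
  assumes qA: "q A \<noteq> 0" and s: "s = 1 \<or> s = - 1"
    and layers: "\<And>u. u \<in> dom A \<Longrightarrow> u $ \<alpha> = a \<or> u $ \<alpha> = a + s"
    and z: "z \<in> dom A" "z $ \<alpha> = a + s"
    and v: "v \<in> dom A" "v $ \<alpha> = a"
  shows "(\<forall>v'\<in>dom A. v' $ \<alpha> = a \<longrightarrow> v' = v) \<and> v + axis \<alpha> s \<in> dom A"
proof (rule ccontr)
  assume contra: "\<not> ?thesis"
  define w where "w = z + axis \<alpha> s"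
  have s0: "s \<noteq> 0"
    using s by auto
  have ss: "s + s \<noteq> 0" "s + s \<noteq> 1" "s + s \<noteq> - 1"
    using double_step_neq[OF length s] by auto
  have w: "w $ \<alpha> = a + (s + s)"
    using z by (simp add: w_def add.assoc)
  have wA: "w \<notin> dom A"
    using layers[of w] w s0 ss by auto
  then have wA': "A w = None"
    by auto
  have zw: "nearest_neighbors z w"
    using nearest_neighbors_axis[OF s] by (simp add: w_def)
  then have "z \<noteq> w"
    by (rule nearest_neighbors_imp_neq)
  obtain R where R: "A z = Some R"
    using z by auto
  \<comment> \<open>Since \<open>W\<close> anticommutes with the factor at \<open>z\<close>, the
    bond term does not cancel \<open>z\<close>, and cancelling \<open>w\<close> again recovers
    \<open>A\<close>.\<close>
  obtain W where W: "J W \<noteq> 0" "W \<noteq> R"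
    by (rule anticommuting_coupling)
  then have anti: "anticommute (A z) (Some W)"
    using R by (auto simp: anticommute_def)
  define B where "B = A(z := pauli_mult (A z) (Some W), w := Some W)"
  have domB: "dom B = insert w (dom A)"
    using anti R by (auto simp: B_def anticommute_def split: if_splits)
  let ?S = "{(x, y). nearest_neighbors x y \<and> anticommute (B x) (B y)}"
  let ?t = "\<lambda>(x, y). J (the (B y)) * pauli_phase (B x) (B y) * q (B(x := pauli_mult (B x) (B y), y := None))"
  \<comment> \<open>Every support containing that of \<open>B\<close> contains \<open>v\<close> and
    \<open>w\<close>, which lie two layers apart.\<close>
  have "sum ?t ?S = 0"
  proof (rule reduced_equation)
    fix A' :: "('l, 'd) pauli_product"
    assume "dom B \<subseteq> dom A'"
    then show "q A' = 0"
      using opposite_layers_vanish[OF s, of v A' w \<alpha>] domB v w by auto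
  qed
  \<comment> \<open>It remains to show that recovering \<open>A\<close> is the only contribution;
    this would force \<open>q A = 0\<close>.\<close>
  moreover have "sum ?t ?S = sum ?t {(z, w)}"
  proof (rule sum.mono_neutral_right)
    show "{(z, w)} \<subseteq> ?S"
      using zw \<open>z \<noteq> w\<close> anti by (auto simp: B_def intro: anticommute_mult)
    show "\<forall>e\<in>?S - {(z, w)}. ?t e = 0"
    proof
      fix e assume "e \<in> ?S - {(z, w)}"
      then obtain x y where e: "e = (x, y)" "(x, y) \<noteq> (z, w)"
        and nn: "nearest_neighbors x y" and an: "anticommute (B x) (B y)"
        by auto
      then have x: "x \<in> insert w (dom A)" and y: "y \<in> insert w (dom A)"
        using domB unfolding anticommute_def by blast+
      have xy: "x \<noteq> y"
        using nn by (rule nearest_neighbors_imp_neq)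
      let ?A' = "B(x := pauli_mult (B x) (B y), y := None)"
      have dom': "dom ?A' = insert w (dom A) - {y}"
        using an domB xy by (auto simp: anticommute_def dom_def split: if_splits)
      have "q ?A' = 0"
      proof (cases "y = w")
        \<comment> \<open>If \<open>w\<close> is cancelled, its partner lies in layer
          \<open>a + s\<close> directly below \<open>w\<close> in the direction of \<open>s\<close>,
          so it is \<open>z\<close>.\<close>
        case True
        with xy x have "x \<in> dom A" by auto
        have "x $ \<alpha> \<noteq> a"
          using nearest_neighbors_coordinate[OF nn, of \<alpha>] True w ss by auto
        with layers[OF \<open>x \<in> dom A\<close>] have "w $ \<alpha> = x $ \<alpha> + s"
          using w by (simp add: add.assoc)
        then have "w = x + axis \<alpha> s"
          using nearest_neighbors_step nn True s0 by blast
        then have "x = z" by (simp add: w_def)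
        with True e show ?thesis by simp
      next
        case False
        show ?thesis
        proof (rule ccontr)
          assume nonzero: "q ?A' \<noteq> 0"
          \<comment> \<open>While \<open>w\<close> stays, a nonzero coefficient leaves no site in
            layer \<open>a\<close>, so the cancelled site \<open>y\<close> was the only one
            there.\<close>
          have y_only: "v' = y" if "v' \<in> dom A" "v' $ \<alpha> = a" for v'
            using that False nonzero opposite_layers_vanish[OF s, of v' ?A' w \<alpha>] w dom' by auto
          then have yv: "y = v"
            using v by auto
          have "x \<noteq> w"
            using nearest_neighbors_coordinate[OF nearest_neighbors_sym[OF nn], of \<alpha>] w v yv ss
            by auto
          then have "x \<in> dom A" using x by auto
          moreover have "x $ \<alpha> \<noteq> a"
            using y_only[OF \<open>x \<in> dom A\<close>] xy by auto
          ultimately have "x $ \<alpha> = y $ \<alpha> + s"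
            using layers[of x] yv v by auto
          \<comment> \<open>The partner of \<open>v\<close> is thus the site opposite to it in layer
            \<open>a + s\<close>. Both parts of the claim would then hold, contrary to
            \<open>contra\<close>.\<close>
          then have "x = v + axis \<alpha> s"
            using nearest_neighbors_step nearest_neighbors_sym nn s0 yv by blast
          with y_only yv \<open>x \<in> dom A\<close> contra show False by blast
        qed
      qed
      then show "?t e = 0" by (simp add: e)
    qed
  qed simp
  moreover have "sum ?t {(z, w)} = ?t (z, w)"
    by simp
  moreover have "B(z := pauli_mult (B z) (B w), w := None) = A"
    using wA' \<open>z \<noteq> w\<close> by (auto simp: B_def fun_eq_iff)
  moreover have "the (B w) = W"
    by (simp add: B_def)
  ultimately have "J W * pauli_phase (B z) (B w) * q A = 0"
    by (simp only: prod.case)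
  with qA W show False by simp
qed

text \<open>In a direction where \<open>u\<close> and \<open>v\<close> differ both layers are
  occupied. Applying \<open>layer_singleton\<close> from either side makes each layer a single site,
  opposite to the other.\<close>

lemma two_sites_neighbors:
  assumes "q A \<noteq> 0" "u \<in> dom A" "v \<in> dom A" "u \<noteq> v"
  shows "nearest_neighbors u v \<and> dom A = {u, v}"
proof -
  obtain \<alpha> where \<alpha>: "u $ \<alpha> \<noteq> v $ \<alpha>"
    using \<open>u \<noteq> v\<close> by (auto simp: vec_eq_iff)
  obtain a where a: "\<forall>x\<in>dom A. x $ \<alpha> = a \<or> x $ \<alpha> = a + 1"
    using width[OF assms(1)] by blast
  have *: "nearest_neighbors x y \<and> dom A = {x, y}"
    if "x \<in> dom A" "y \<in> dom A" "x $ \<alpha> = a" "y $ \<alpha> = a + 1" for x y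
  proof -
    have lower: "(\<forall>x'\<in>dom A. x' $ \<alpha> = a \<longrightarrow> x' = x) \<and> x + axis \<alpha> 1 \<in> dom A"
      by (rule layer_singleton[where z = y]) (use assms that a in auto)
    \<comment> \<open>Here \<open>s = - 1\<close> and the base layer is \<open>a + 1\<close>, so the
      roles of the two layers are exchanged.\<close>
    have upper: "(\<forall>y'\<in>dom A. y' $ \<alpha> = a + 1 \<longrightarrow> y' = y) \<and> y + axis \<alpha> (- 1) \<in> dom A"
      by (rule layer_singleton[where z = x]) (use assms that a in auto)
    have "(x + axis \<alpha> 1) $ \<alpha> = a + 1"
      using that by simp
    with lower upper have "x + axis \<alpha> 1 = y"
      by blast
    then have "nearest_neighbors x y"
      using nearest_neighbors_axis[of 1 x \<alpha>] by simp
    moreover have "dom A = {x, y}"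
      using lower upper a that by blast
    ultimately show ?thesis ..
  qed
  show ?thesis
  proof (cases "u $ \<alpha> = a")
    case True
    with bspec[OF a assms(3)] \<alpha> show ?thesis
      using *[of u v] assms by auto
  next
    case False
    with bspec[OF a assms(2)] bspec[OF a assms(3)] \<alpha> have "u $ \<alpha> = a + 1" "v $ \<alpha> = a"
      by auto
    with *[of v u] assms show ?thesis
      by (auto intro: nearest_neighbors_sym)
  qed
qed

section \<open>Equations from two bonds sharing a site\<close>

lemma path_equation:
  assumes uv: "nearest_neighbors u v" and uw: "nearest_neighbors u w" and "v \<noteq> w"
    and "T \<noteq> P" "T \<noteq> W"
  shows "J W * pauli_phase (Some T) (Some W) * q [v \<mapsto> P, u \<mapsto> third_pauli T W] +
    J P * pauli_phase (Some T) (Some P) * q [u \<mapsto> third_pauli T P, w \<mapsto> W] = 0"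
proof -
  define B where "B = [v \<mapsto> P, u \<mapsto> T, w \<mapsto> W]"
  have "u \<noteq> v" "u \<noteq> w"
    using uv uw by (auto dest: nearest_neighbors_imp_neq)
  note neq = this \<open>v \<noteq> w\<close>
  have vw: "\<not> nearest_neighbors v w" "\<not> nearest_neighbors w v"
    using nearest_neighbors_triangle_free[OF length] uv uw by blast+
  have B: "B u = Some T" "B v = Some P" "B w = Some W" and domB: "dom B = {u, v, w}"
    using neq by (auto simp: B_def)
  let ?S = "{(x, y). nearest_neighbors x y \<and> anticommute (B x) (B y)}"
  let ?t = "\<lambda>(x, y). J (the (B y)) * pauli_phase (B x) (B y) * q (B(x := pauli_mult (B x) (B y), y := None))"
  \<comment> \<open>\<open>B\<close> acts on three sites, and supports with more than two sites have
    coefficient zero.\<close>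
  have "sum ?t ?S = 0"
  proof (rule reduced_equation, rule ccontr)
    fix A :: "('l, 'd) pauli_product"
    assume "dom B \<subseteq> dom A" "q A \<noteq> 0"
    then show False
      using two_sites_neighbors[of A u v] domB neq by auto
  qed
  moreover have "sum ?t ?S = sum ?t {(u, w), (u, v)}"
  proof (rule sum.mono_neutral_right)
    show "{(u, w), (u, v)} \<subseteq> ?S"
      using assms B by (auto simp: anticommute_def)
    show "\<forall>e\<in>?S - {(u, w), (u, v)}. ?t e = 0"
    proof
      fix e assume "e \<in> ?S - {(u, w), (u, v)}"
      then obtain x y where e: "e = (x, y)" "(x, y) \<noteq> (u, w)" "(x, y) \<noteq> (u, v)"
        and nn: "nearest_neighbors x y" and an: "anticommute (B x) (B y)"
        by auto
      then have "x \<in> dom B" "y \<in> dom B"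
        by (auto simp: anticommute_def)
      with e nn domB vw have y: "y = u" and x: "x = v \<or> x = w"
        using nearest_neighbors_imp_neq[OF nn] by auto
      let ?A = "B(x := pauli_mult (B x) (B y), y := None)"
      \<comment> \<open>Cancelling the middle site \<open>u\<close> leaves \<open>v\<close> and
        \<open>w\<close>, which are not neighbors because there are no triangles.\<close>
      have "{v, w} \<subseteq> dom ?A"
        using x y neq B an by (auto simp: anticommute_def split: if_splits)
      then have "q ?A = 0"
        using two_sites_neighbors[of _ v w] vw(1) \<open>v \<noteq> w\<close> by blast
      then show "?t e = 0" by (simp add: e)
    qed
  qed simp
  moreover have "sum ?t {(u, w), (u, v)} = ?t (u, w) + ?t (u, v)"
    using \<open>v \<noteq> w\<close> by simp
  moreover have "B(u := pauli_mult (B u) (B w), w := None) = [v \<mapsto> P, u \<mapsto> third_pauli T W]"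
    using neq assms by (auto simp: B_def fun_eq_iff)
  moreover have "B(u := pauli_mult (B u) (B v), v := None) = [u \<mapsto> third_pauli T P, w \<mapsto> W]"
    using neq assms by (auto simp: B_def fun_eq_iff)
  ultimately show ?thesis
    by (simp only: prod.case B option.sel)
qed

lemma unequal_pair_vanishes:
  assumes uv: "nearest_neighbors u v" and "P \<noteq> R"
  shows "q [u \<mapsto> R, v \<mapsto> P] = 0"
proof -
  have main: "q [v \<mapsto> P, u \<mapsto> R] = 0" if uv: "nearest_neighbors u v" and "P \<noteq> R" and JP: "J P \<noteq> 0"
    for u v P R
  proof -
    obtain w x where w: "nearest_neighbors u w" "w \<noteq> v" and x: "nearest_neighbors u x" "x \<noteq> v"
      and "w \<noteq> x"
      using third_neighbors[OF dimension length uv] by metis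
    \<comment> \<open>With this choice, multiplying \<open>T\<close> by \<open>P\<close> gives
      \<open>R\<close>, so both terms of \<open>path_equation\<close> carry the pair
      \<open>P\<close>, \<open>R\<close>.\<close>
    define T where "T = third_pauli R P"
    have T: "T \<noteq> P" "third_pauli T P = R"
      using \<open>P \<noteq> R\<close> by (cases P; cases R; simp add: T_def)+
    have flip: "q [v \<mapsto> P, u \<mapsto> R] = - q [w \<mapsto> P, u \<mapsto> R]"
      if "nearest_neighbors u v" "nearest_neighbors u w" "v \<noteq> w" for v w
    proof -
      have "J P * pauli_phase (Some T) (Some P) * (q [v \<mapsto> P, u \<mapsto> R] + q [u \<mapsto> R, w \<mapsto> P]) = 0"
        using path_equation[OF that T(1) T(1)] by (simp add: T distrib_left)
      moreover have "[u \<mapsto> R, w \<mapsto> P] = [w \<mapsto> P, u \<mapsto> R]"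
        using nearest_neighbors_imp_neq[OF that(2)] by (rule fun_upd_twist)
      ultimately show ?thesis
        using JP by (simp add: eq_neg_iff_add_eq_0)
    qed
    \<comment> \<open>Three sign changes, from \<open>v\<close> to \<open>w\<close> to
      \<open>x\<close> and back to \<open>v\<close>, make the coefficient equal to its own
      negative.\<close>
    from flip[OF uv w(1)] flip[OF w(1) x(1) \<open>w \<noteq> x\<close>] flip[OF uv x(1)] w x
    show ?thesis by simp
  qed
  have neq: "u \<noteq> v"
    using uv by (rule nearest_neighbors_imp_neq)
  \<comment> \<open>One of two different labels is X or Y. If only \<open>R\<close> is known to
    couple, the ends of the bond exchange roles.\<close>
  have "J P \<noteq> 0 \<or> J R \<noteq> 0"
    using \<open>P \<noteq> R\<close> JX JY by (cases P; cases R) auto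
  then show ?thesis
  proof
    assume "J P \<noteq> 0"
    from main[OF uv \<open>P \<noteq> R\<close> this] show ?thesis
      using neq by (simp add: fun_upd_twist)
  next
    assume "J R \<noteq> 0"
    from main[OF nearest_neighbors_sym[OF uv] \<open>P \<noteq> R\<close>[symmetric] this] show ?thesis .
  qed
qed

lemma adjacent_bonds:
  assumes "nearest_neighbors u v" "nearest_neighbors u w" "v \<noteq> w" "P \<noteq> W"
  shows "J W * q [u \<mapsto> P, v \<mapsto> P] = J P * q [u \<mapsto> W, w \<mapsto> W]"
proof -
  \<comment> \<open>Multiplying the third label by \<open>W\<close> gives \<open>P\<close> and by
    \<open>P\<close> gives \<open>W\<close>, with opposite phases; this sign turns the sum in
    \<open>path_equation\<close> into an equality.\<close>
  define T where "T = third_pauli P W"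
  have T: "T \<noteq> P" "T \<noteq> W" "third_pauli T W = P" "third_pauli T P = W"
    "pauli_phase (Some T) (Some P) = - pauli_phase (Some T) (Some W)"
    using \<open>P \<noteq> W\<close> by (cases P; cases W; simp add: T_def)+
  have "[v \<mapsto> P, u \<mapsto> P] = [u \<mapsto> P, v \<mapsto> P]"
    using nearest_neighbors_imp_neq[OF assms(1)] by (simp add: fun_upd_twist)
  then have "pauli_phase (Some T) (Some W) *
      (J W * q [u \<mapsto> P, v \<mapsto> P] - J P * q [u \<mapsto> W, w \<mapsto> W]) = 0"
    using path_equation[OF assms(1-3) T(1,2)] by (simp add: T algebra_simps)
  then show ?thesis by simp
qed

text \<open>The ratios for X and Y agree crosswise on different bonds at a site. Two further
  neighbors make them agree on all bonds there, and reversing a bond carries the common value to the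
  next site.\<close>

lemma bond_proportional:
  obtains g where "\<And>u v P. nearest_neighbors u v \<Longrightarrow> q [u \<mapsto> P, v \<mapsto> P] = g * J P"
proof -
  \<comment> \<open>\<open>G\<close> is evaluated only at \<open>PX\<close> and \<open>PY\<close>,
    where the divisor is nonzero.\<close>
  define G where "G P u v = q [u \<mapsto> P, v \<mapsto> P] / J P" for P u v
  have XY: "G PX u v = G PY u w" if "nearest_neighbors u v" "nearest_neighbors u w" "v \<noteq> w" for u v w
    using adjacent_bonds[OF that, of PX PY] JX JY by (simp add: G_def field_simps)
  have around: "G PX u v = G PX u v' \<and> G PY u v = G PX u v'"
    if uv: "nearest_neighbors u v" and uv': "nearest_neighbors u v'" for u v v'
  proof -
    obtain w x where "nearest_neighbors u w" "nearest_neighbors u x" "w \<noteq> v" "x \<noteq> v" "w \<noteq> x"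
      using third_neighbors[OF dimension length uv] by metis
    with uv uv' XY show ?thesis by metis
  qed
  \<comment> \<open>\<open>undefined\<close> merely picks some direction; by \<open>around\<close>
    the value is the same for every bond at \<open>u\<close>.\<close>
  define c where "c u = G PX u (u + axis undefined 1)" for u
  have nn: "nearest_neighbors u (u + axis undefined 1)" for u :: "('l, 'd) site"
    by (simp add: nearest_neighbors_axis)
  have Gc: "G PX u v = c u" "G PY u v = c u" if "nearest_neighbors u v" for u v
    using around[OF that nn] by (simp_all add: c_def)
  have "c u = c v" if uv: "nearest_neighbors u v" for u v
  proof -
    have "[u \<mapsto> PX, v \<mapsto> PX] = [v \<mapsto> PX, u \<mapsto> PX]"
      using nearest_neighbors_imp_neq[OF uv] by (rule fun_upd_twist)
    then have "G PX u v = G PX v u"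
      by (simp add: G_def)
    with Gc uv nearest_neighbors_sym[OF uv] show ?thesis by simp
  qed
  then have c: "c u = c 0" for u
    by (rule nearest_neighbors_invariant_constant)
  have "q [u \<mapsto> P, v \<mapsto> P] = c 0 * J P" if uv: "nearest_neighbors u v" for u v P
  proof (cases P)
    case PX
    with Gc(1)[OF uv] c[of u] JX show ?thesis by (simp add: G_def field_simps)
  next
    case PY
    with Gc(2)[OF uv] c[of u] JY show ?thesis by (simp add: G_def field_simps)
  next
    case PZ
    \<comment> \<open>The coefficient for Z is compared with that for X on another bond and divided
      by \<open>J PX\<close>, so \<open>J PZ\<close> may be zero.\<close>
    obtain w where w: "nearest_neighbors u w" "v \<noteq> w"
      using third_neighbors[OF dimension length uv] by metis
    have "q [u \<mapsto> PX, w \<mapsto> PX] = c 0 * J PX"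
      using Gc(1)[OF w(1)] c[of u] JX by (simp add: G_def field_simps)
    with adjacent_bonds[OF uv w, of PZ PX] JX PZ show ?thesis by simp
  qed
  then show ?thesis by (rule that)
qed

text \<open>The empty map remains because the identity commutes with every operator, so the
  equations cannot restrict its coefficient.\<close>

lemma support_cases:
  assumes "q A \<noteq> 0"
  obtains "A = Map.empty" | u P where "A = [u \<mapsto> P]"
  | u v P where "nearest_neighbors u v" "A = [u \<mapsto> P, v \<mapsto> P]"
proof (cases "\<exists>u\<in>dom A. \<exists>v\<in>dom A. u \<noteq> v")
  case True
  then obtain u v where uv: "u \<in> dom A" "v \<in> dom A" "u \<noteq> v" by blast
  then have nn: "nearest_neighbors u v" and dom: "dom A = {u, v}"
    using two_sites_neighbors[OF assms] by auto
  obtain P R where PR: "A u = Some R" "A v = Some P"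
    using uv by auto
  have A: "A = [u \<mapsto> R, v \<mapsto> P]"
  proof
    fix x
    show "A x = [u \<mapsto> R, v \<mapsto> P] x"
      using PR dom uv by (cases "x \<in> dom A") auto
  qed
  with unequal_pair_vanishes[OF nn] assms have "P = R" by metis
  with A nn that(3) show ?thesis by blast
next
  case False
  then consider "dom A = {}" | u where "dom A = {u}"
    by blast
  then show ?thesis
  proof cases
    case 1
    with that(1) show ?thesis by simp
  next
    case 2
    with that(2) show ?thesis by (metis dom_eq_singleton_conv)
  qed
qed

end

section \<open>Conserved quantities of width two\<close>

lemma Wid_le_2_imp_layers:
  fixes S :: "('l::nontriv, 'd::finite) site set"
  assumes "Wid S \<le> 2"
  shows "\<exists>a. \<forall>u\<in>S. u $ \<alpha> = a \<or> u $ \<alpha> = a + 1"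
proof -
  let ?P = "\<lambda>k. \<exists>a. \<forall>u\<in>S. to_int_mod_ring (u $ \<alpha> - a) \<in> {0..<int k}"
  have "to_int_mod_ring x \<in> {0..<int CARD('l)}" for x :: "'l mod_ring"
    using range_to_int_mod_ring[where 'a = 'l] by blast
  \<comment> \<open>A witness is needed before \<open>LEAST\<close> has its property: a window of
    length \<open>L\<close> contains all residues.\<close>
  then have "?P CARD('l)" by blast
  then have "?P (Wid_along \<alpha> S)"
    unfolding Wid_along_def by (rule LeastI)
  moreover have "Wid_along \<alpha> S \<le> 2"
    using assms unfolding Wid_def by (meson Max_ge finite_imageI finite rangeI order_trans)
  ultimately obtain a where a: "\<And>u. u \<in> S \<Longrightarrow> to_int_mod_ring (u $ \<alpha> - a) \<in> {0..<2}"
    by (fastforce intro: order_less_le_trans)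
  have "u $ \<alpha> = a \<or> u $ \<alpha> = a + 1" if "u \<in> S" for u
  proof -
    have "k = 0 \<or> k = 1" if "k \<in> {0..<2}" for k :: int
      using that by auto
    from this[OF a[OF that]] have "u $ \<alpha> - a = 0 \<or> u $ \<alpha> - a = 1"
      by simp
    then show ?thesis by (auto simp: algebra_simps)
  qed
  then show ?thesis by blast
qed

lemma Wid_singleton_le_1: "Wid {u} \<le> 1"
proof -
  have "Wid_along \<alpha> {u} \<le> 1" for \<alpha>
    unfolding Wid_along_def by (rule Least_le) (auto intro!: exI[of _ "u $ \<alpha>"])
  then show ?thesis
    unfolding Wid_def by (simp add: image_subset_iff)
qed

text \<open>Summing over ordered pairs counts every bond product twice, which matches the factor 1/2
  in the Hamiltonian.\<close>

lemma bond_product_fiber: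
  assumes "nearest_neighbors u v"
  shows "{(w, x, r). nearest_neighbors w x \<and> [w \<mapsto> r, x \<mapsto> r] = [u \<mapsto> p, v \<mapsto> p]} =
    {(u, v, p), (v, u, p)}"
proof -
  have "(w = u \<and> x = v \<or> w = v \<and> x = u) \<and> r = p"
    if nn: "nearest_neighbors w x" and eq: "[w \<mapsto> r, x \<mapsto> r] = [u \<mapsto> p, v \<mapsto> p]" for w x r
  proof -
    have "dom [w \<mapsto> r, x \<mapsto> r] = dom [u \<mapsto> p, v \<mapsto> p]"
      using eq by simp
    then have "{w, x} = {u, v}" by auto
    moreover have "[w \<mapsto> r, x \<mapsto> r] x = [u \<mapsto> p, v \<mapsto> p] x"
      using eq by simp
    ultimately show ?thesis
      by (auto simp: doubleton_eq_iff split: if_splits)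
  qed
  moreover have "[v \<mapsto> p, u \<mapsto> p] = [u \<mapsto> p, v \<mapsto> p]"
    using nearest_neighbors_imp_neq[OF assms] by (simp add: fun_upd_twist)
  ultimately show ?thesis
    using assms nearest_neighbors_sym[OF assms] by auto
qed

text \<open>The nonzero summands lie in the images of the bond map, which is two-to-one, and of the
  site map, which is injective; support sizes separate the images.\<close>

lemma sum_bonds_and_sites:
  fixes f :: "('l::nontriv, 'd::finite) pauli_product \<Rightarrow> ('l, 'd) operator"
  assumes supp: "\<And>A. f A \<noteq> 0 \<Longrightarrow> (\<exists>u p. A = [u \<mapsto> p]) \<or>
      (\<exists>u v p. nearest_neighbors u v \<and> A = [u \<mapsto> p, v \<mapsto> p])"
  shows "(\<Sum>A\<in>UNIV. f A) =
    (1 / 2) *\<^sub>c (\<Sum>(u, v)\<in>{(u, v). nearest_neighbors u v}. \<Sum>p\<in>UNIV. f [u \<mapsto> p, v \<mapsto> p])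
    + (\<Sum>u\<in>UNIV. \<Sum>p\<in>UNIV. f [u \<mapsto> p])"
proof -
  let ?T = "{(u :: ('l, 'd) site, v, p :: pauli). nearest_neighbors u v}"
  let ?\<phi> = "\<lambda>(u :: ('l, 'd) site, v, p :: pauli). [u \<mapsto> p, v \<mapsto> p]"
  let ?\<psi> = "\<lambda>(u :: ('l, 'd) site, p :: pauli). [u \<mapsto> p]"
  have disjoint: "?\<phi> ` ?T \<inter> range ?\<psi> = {}"
  proof -
    have "[u \<mapsto> p, v \<mapsto> p] \<noteq> [w \<mapsto> r]" if "nearest_neighbors u v" for u v w :: "('l, 'd) site" and p r :: pauli
    proof
      assume "[u \<mapsto> p, v \<mapsto> p] = [w \<mapsto> r]"
      then have "dom [u \<mapsto> p, v \<mapsto> p] = dom [w \<mapsto> r]" by simp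
      then show False using nearest_neighbors_imp_neq[OF that] by auto
    qed
    then show ?thesis by fastforce
  qed
  have "A \<in> ?\<phi> ` ?T \<union> range ?\<psi>" if "f A \<noteq> 0" for A
    using supp[OF that]
  proof (elim disjE exE conjE)
    fix u p assume "A = [u \<mapsto> p]"
    then have "A = ?\<psi> (u, p)" by simp
    then show ?thesis by (intro UnI2) (rule range_eqI)
  next
    fix u v p assume "nearest_neighbors u v" "A = [u \<mapsto> p, v \<mapsto> p]"
    then have "A = ?\<phi> (u, v, p)" "(u, v, p) \<in> ?T" by simp_all
    then show ?thesis by (intro UnI1) (rule image_eqI)
  qed
  then have "(\<Sum>A\<in>UNIV. f A) = (\<Sum>A\<in>?\<phi> ` ?T \<union> range ?\<psi>. f A)"
    by (intro sum.mono_neutral_right) (simp, simp, blast)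
  also have "\<dots> = (\<Sum>A\<in>?\<phi> ` ?T. f A) + (\<Sum>A\<in>range ?\<psi>. f A)"
    by (rule sum.union_disjoint) (use disjoint in auto)
  also have "(\<Sum>A\<in>range ?\<psi>. f A) = (\<Sum>u\<in>UNIV. \<Sum>p\<in>UNIV. f [u \<mapsto> p])"
  proof -
    have "inj ?\<psi>"
    proof (rule injI, clarify)
      fix u w p r assume eq: "[u \<mapsto> p] = [w \<mapsto> r]"
      then have "dom [u \<mapsto> p] = dom [w \<mapsto> r]" by simp
      then have "u = w" by simp
      with fun_cong[OF eq, of u] show "u = w \<and> p = r" by simp
    qed
    then show ?thesis
      by (simp add: sum.reindex sum.cartesian_product case_prod_unfold)
  qed
  also have "(\<Sum>A\<in>?\<phi> ` ?T. f A) = (1 / 2) *\<^sub>c (\<Sum>t\<in>?T. f (?\<phi> t))"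
  proof -
    have fiber: "(\<Sum>t\<in>{t \<in> ?T. ?\<phi> t = A}. f (?\<phi> t)) = 2 *\<^sub>c f A" if bond: "A \<in> ?\<phi> ` ?T" for A
    proof -
      obtain u v p where nn: "nearest_neighbors u v" and A: "A = [u \<mapsto> p, v \<mapsto> p]"
        using bond by auto
      have "{t \<in> ?T. ?\<phi> t = A} = {(u, v, p), (v, u, p)}"
        unfolding A bond_product_fiber[OF nn, symmetric] by auto
      moreover have "[v \<mapsto> p, u \<mapsto> p] = [u \<mapsto> p, v \<mapsto> p]"
        using nearest_neighbors_imp_neq[OF nn] by (simp add: fun_upd_twist)
      ultimately show ?thesis
        using nearest_neighbors_imp_neq[OF nn] cscale_add_left[of 1 1 "f A"] by (simp add: A)
    qed
    have "(\<Sum>t\<in>?T. f (?\<phi> t)) = (\<Sum>A\<in>?\<phi> ` ?T. \<Sum>t\<in>{t \<in> ?T. ?\<phi> t = A}. f (?\<phi> t))"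
      by (rule sum.image_gen) simp
    also have "\<dots> = 2 *\<^sub>c (\<Sum>A\<in>?\<phi> ` ?T. f A)"
      unfolding cscale_sum_right using fiber by (rule sum.cong[OF refl])
    finally show ?thesis
      by (simp add: cscale_cscale)
  qed
  also have "(\<Sum>t\<in>?T. f (?\<phi> t)) =
      (\<Sum>(u, v)\<in>{(u, v). nearest_neighbors u v}. \<Sum>p\<in>UNIV. f [u \<mapsto> p, v \<mapsto> p])"
    unfolding case_prod_unfold sum.cartesian_product
    by (rule sum.reindex_bij_witness[of _ "\<lambda>((u, v), p). (u, v, p)" "\<lambda>(u, v, p). ((u, v), p)"]) auto
  finally show ?thesis .
qed

theorem theorem2p2:
  fixes J\<^sub>X J\<^sub>Y J\<^sub>Z h\<^sub>X h\<^sub>Y h\<^sub>Z :: real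
    and q :: "('l::nontriv, 'd::finite) pauli_product \<Rightarrow> complex"
    and H Q :: "('l, 'd) operator"
  assumes "CARD('d) \<ge> 2" and "CARD('l) \<ge> 4"
    and "J\<^sub>X \<noteq> 0" and "J\<^sub>Y \<noteq> 0"
    and "H = hamiltonian J\<^sub>X J\<^sub>Y J\<^sub>Z h\<^sub>X h\<^sub>Y h\<^sub>Z"
    and "Q = (\<Sum>A \<in> {A \<in> products. Wid (dom A) \<le> 2}. q A *\<^sub>c product_op A)"
    and "\<exists>A \<in> products. Wid (dom A) = 2 \<and> q A \<noteq> 0"
    and "H ** Q - Q ** H = 0"
  shows "\<exists>\<eta> Q1. \<eta> \<noteq> 0 \<and> one_body Q1 \<and> Q = \<eta> *\<^sub>c H + Q1"
proof -
  \<comment> \<open>Extension by zero: the sum can run over all maps, the width bound holds wherever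
    \<open>q'\<close> is nonzero, and the identity gets coefficient 0.\<close>
  define q' where "q' A = (if A \<in> products \<and> Wid (dom A) \<le> 2 then q A else 0)" for A
  define J where "J p = complex_of_real (case_pauli J\<^sub>X J\<^sub>Y J\<^sub>Z p)" for p
  define h where "h p = complex_of_real (case_pauli h\<^sub>X h\<^sub>Y h\<^sub>Z p)" for p
  let ?N = "{(u :: ('l, 'd) site, v). nearest_neighbors u v}"
  have Q: "Q = (\<Sum>A\<in>UNIV. q' A *\<^sub>c product_op A)"
    unfolding assms(6) by (rule sum.mono_neutral_cong_left) (auto simp: q'_def)
  interpret width_two_solution J h q'
  proof
    show "(\<Sum>(x, y)\<in>?N. \<Sum>p\<in>UNIV. J p * bond_coeff q' B p x y)
      + (\<Sum>x\<in>UNIV. \<Sum>p\<in>UNIV. h p * site_coeff q' B p x) = 0" for B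
      unfolding J_def h_def by (rule commuting_imp_coefficient_equation[OF assms(5) Q assms(8)])
    show "\<exists>a. \<forall>u\<in>dom A. u $ \<alpha> = a \<or> u $ \<alpha> = a + 1" if "q' A \<noteq> 0" for A \<alpha>
      using that by (intro Wid_le_2_imp_layers) (auto simp: q'_def split: if_splits)
  qed (use assms in \<open>simp_all add: J_def\<close>)
  obtain g where g: "\<And>u v P. nearest_neighbors u v \<Longrightarrow> q' [u \<mapsto> P, v \<mapsto> P] = g * J P"
    using bond_proportional by blast
  have q'_empty: "q' Map.empty = 0"
    by (simp add: q'_def products_def)
  \<comment> \<open>The product of width 2 with nonzero coefficient is neither empty nor a single
    site, so it sits on a bond and its coefficient is a multiple of \<open>g\<close>.\<close>
  have "g \<noteq> 0"
  proof
    assume "g = 0"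
    obtain A where A: "A \<in> products" "Wid (dom A) = 2" "q A \<noteq> 0"
      using assms(7) by blast
    then have "q' A \<noteq> 0" by (simp add: q'_def)
    then show False
    proof (cases rule: support_cases)
      case 1
      with A show False by (simp add: products_def)
    next
      case (2 u P)
      with A Wid_singleton_le_1[of u] show False by simp
    next
      case (3 u v P)
      with g \<open>g = 0\<close> \<open>q' A \<noteq> 0\<close> show False by simp
    qed
  qed
  \<comment> \<open>The multiple of the Hamiltonian brings field terms with it; they are subtracted
    here. Since the Hamiltonian carries a minus sign, the factor \<open>\<eta>\<close> will be
    \<open>- g\<close>.\<close>
  define c where "c p u = q' [u \<mapsto> p] - g * h p" for p and u :: "('l, 'd) site"
  define Q1 :: "('l, 'd) operator" where
    "Q1 = (\<Sum>u\<in>UNIV. \<Sum>p\<in>UNIV. c p u *\<^sub>c product_op [u \<mapsto> p])"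
  have combine: "(1 / 2) *\<^sub>c g *\<^sub>c X + (g *\<^sub>c Y + Q1) = (- g) *\<^sub>c ((- 1 / 2) *\<^sub>c X - Y) + Q1"
    for X Y :: "('l, 'd) operator"
    by (simp add: vec_eq_iff cscale_def algebra_simps)
  have "one_body Q1"
    unfolding one_body_def
    by (rule exI[of _ c]) (simp add: Q1_def site_op_eq UNIV_pauli add.assoc)
  have "Q = (1 / 2) *\<^sub>c (\<Sum>(u, v)\<in>?N. \<Sum>p\<in>UNIV. q' [u \<mapsto> p, v \<mapsto> p] *\<^sub>c product_op [u \<mapsto> p, v \<mapsto> p])
    + (\<Sum>u\<in>UNIV. \<Sum>p\<in>UNIV. q' [u \<mapsto> p] *\<^sub>c product_op [u \<mapsto> p])"
    unfolding Q
  proof (rule sum_bonds_and_sites)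
    fix A :: "('l, 'd) pauli_product"
    assume "q' A *\<^sub>c product_op A \<noteq> (0 :: ('l, 'd) operator)"
    then have "q' A \<noteq> 0" by auto
    then show "(\<exists>u p. A = [u \<mapsto> p]) \<or> (\<exists>u v p. nearest_neighbors u v \<and> A = [u \<mapsto> p, v \<mapsto> p])"
    proof (cases rule: support_cases)
      case 1
      with q'_empty \<open>q' A \<noteq> 0\<close> show ?thesis by simp
    qed blast+
  qed
  also have "(\<Sum>(u, v)\<in>?N. \<Sum>p\<in>UNIV. q' [u \<mapsto> p, v \<mapsto> p] *\<^sub>c product_op [u \<mapsto> p, v \<mapsto> p]) =
      g *\<^sub>c (\<Sum>(u, v)\<in>?N. \<Sum>p\<in>UNIV. J p *\<^sub>c product_op [u \<mapsto> p, v \<mapsto> p])"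
    unfolding cscale_sum_right by (rule sum.cong) (auto simp: g cscale_sum_right cscale_cscale)
  also have "(\<Sum>u\<in>UNIV. \<Sum>p\<in>UNIV. q' [u \<mapsto> p] *\<^sub>c product_op [u \<mapsto> p]) =
      g *\<^sub>c (\<Sum>u\<in>UNIV. \<Sum>p\<in>UNIV. h p *\<^sub>c product_op [u \<mapsto> p]) + Q1"
    by (simp add: Q1_def c_def cscale_sum_right cscale_cscale sum.distrib[symmetric]
        cscale_add_left[symmetric])
  finally have "Q = (- g) *\<^sub>c H + Q1"
    unfolding assms(5) hamiltonian_eq J_def[symmetric] h_def[symmetric]
    by (simp only: combine)
  with \<open>g \<noteq> 0\<close> \<open>one_body Q1\<close> show ?thesis
    by (metis neg_equal_0_iff_equal)
qed

end
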